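(* Let $Z$ be a Zinbiel algebra over an arbitrary field $F$ and let $A$ be an abelian subalgebra of codimension one in $Z$. Then $A$ is an ideal of $Z$.
   Context: A Zinbiel algebra over a field $F$ is an $F$-vector space $Z$ with a bilinear product $[\cdot,\cdot]$ satisfying the Zinbiel identity $[[x,y],z]=[x,[y,z]]+[x,[z,y]]$ for all $x,y,z\in Z$. A subalgebra $A$ is abelian if $[a,b]=0$ for all $a,b\in A$. An ideal is two-sided: a subspace $I$ with $[Z,I]\subseteq I$ and $[I,Z]\subseteq I$. *)

theory Defs
  imports Main HOL.Vector_Spaces
begin

context vector_space
begin

text \<open>
  \<open>has_codimension A n\<close> says that the quotient of the whole space by \<open>A\<close> has dimension \<open>n\<close>.
  A basis of the quotient is given by a set \<open>B\<close> of coset representatives: the cosets of the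
  elements of \<open>B\<close> are (pairwise distinct and) linearly independent in the quotient iff no
  non-trivial linear combination of elements of \<open>B\<close> lies in \<open>A\<close>, and they generate the quotient
  iff \<open>A \<union> B\<close> generates the whole space. The space itself may be infinite-dimensional.
\<close>

definition independent_modulo :: "'b set \<Rightarrow> 'b set \<Rightarrow> bool" where
  "independent_modulo A B \<longleftrightarrow>
    (\<forall>T u. finite T \<longrightarrow> T \<subseteq> B \<longrightarrow> (\<Sum>v\<in>T. scale (u v) v) \<in> A \<longrightarrow> (\<forall>v\<in>T. u v = 0))"

definition has_codimension :: "'b set \<Rightarrow> nat \<Rightarrow> bool" where
  "has_codimension A n \<longleftrightarrow> subspace A \<and>
    (\<exists>B. finite B \<and> card B = n \<and> independent_modulo A B \<and> span (A \<union> B) = UNIV)"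

end

locale zinbiel_algebra = vector_space scale
  for scale :: "'f::field \<Rightarrow> 'z::ab_group_add \<Rightarrow> 'z" +
  fixes br :: "'z \<Rightarrow> 'z \<Rightarrow> 'z"
  assumes linear_left: "Vector_Spaces.linear scale scale (\<lambda>x. br x y)"
    and linear_right: "Vector_Spaces.linear scale scale (\<lambda>y. br x y)"
    and zinbiel_identity: "br (br x y) z = br x (br y z) + br x (br z y)"
begin

definition subalgebra :: "'z set \<Rightarrow> bool" where
  "subalgebra A \<longleftrightarrow> subspace A \<and> (\<forall>a\<in>A. \<forall>b\<in>A. br a b \<in> A)"

definition abelian_subalgebra :: "'z set \<Rightarrow> bool" where
  "abelian_subalgebra A \<longleftrightarrow> subalgebra A \<and> (\<forall>a\<in>A. \<forall>b\<in>A. br a b = 0)"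

definition two_sided_ideal :: "'z set \<Rightarrow> bool" where
  "two_sided_ideal I \<longleftrightarrow> subspace I \<and> (\<forall>z. \<forall>x\<in>I. br z x \<in> I \<and> br x z \<in> I)"

end

end

theory Submission imports Defs begin

text \<open>
  Write \<open>Z = A + F b\<close>. For \<open>a, a'\<close> in \<open>A\<close> the product \<open>[b, a]\<close> is \<open>g b\<close> plus an element of \<open>A\<close>, and
  \<open>0 = [b, [a, a'] + [a', a]] = [[b, a], a'] = g [b, a']\<close>. Taking \<open>a' = a\<close>, either \<open>g = 0\<close> or
  \<open>[b, a] = 0\<close>; in both cases \<open>[b, a]\<close> lies in \<open>A\<close>. Hence \<open>[a, [b, a]] = 0\<close>. Now \<open>[a, b]\<close> is
  \<open>f b\<close> plus an element of \<open>A\<close>, and \<open>0 = [[a, a], b] = [a, [a, b]] + [a, [b, a]] = f [a, b]\<close>, so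
  \<open>[a, b]\<close> lies in \<open>A\<close> for the same reason.
\<close>

text \<open>\<open>span_breakdown_eq\<close> splits \<open>b\<close> off the spanning set; the
  remainder lies in \<open>span A\<close>, which is \<open>A\<close> for a subspace.\<close>

lemma (in vector_space) codimension_one_decomp:
  assumes "has_codimension A 1"
  obtains b where "\<And>z. \<exists>k. z - scale k b \<in> A"
proof -
  from assms obtain B where "subspace A" "card B = 1" "span (A \<union> B) = UNIV"
    unfolding has_codimension_def by blast
  then obtain b where "span (insert b A) = UNIV"
    by (auto simp: card_1_singleton_iff)
  with \<open>subspace A\<close> have "\<exists>k. z - scale k b \<in> A" for z
    using span_breakdown_eq[of z b A] by (simp add: span_eq_iff[THEN iffD2])
  then show thesis by (rule that)
qed

context zinbiel_algebra
begin

lemma br_add_left: "br (x + y) z = br x z + br y z"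
  and br_scale_left: "br (scale c x) z = scale c (br x z)"
  and br_add_right: "br x (y + z) = br x y + br x z"
  and br_scale_right: "br x (scale c y) = scale c (br x y)"
  and br_zero_left: "br 0 x = 0"
  and br_zero_right: "br x 0 = 0"
proof -
  interpret left: Vector_Spaces.linear scale scale "\<lambda>x. br x y" for y
    by (rule linear_left)
  interpret right: Vector_Spaces.linear scale scale "\<lambda>y. br x y" for x
    by (rule linear_right)
  show "br (x + y) z = br x z + br y z" "br (scale c x) z = scale c (br x z)"
    "br x (y + z) = br x y + br x z" "br x (scale c y) = scale c (br x y)"
    "br 0 x = 0" "br x 0 = 0"
    by (rule left.add left.scale right.add right.scale left.zero right.zero)+
qed

lemma abelian_codimension_one_ideal:
  assumes abelian: "abelian_subalgebra A" and cod: "has_codimension A 1"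
  shows "two_sided_ideal A"
proof -
  have sub: "subspace A" and br0: "\<And>x y. x \<in> A \<Longrightarrow> y \<in> A \<Longrightarrow> br x y = 0"
    using abelian by (auto simp: abelian_subalgebra_def subalgebra_def)
  obtain b where b: "\<And>z. \<exists>k. z - scale k b \<in> A"
    using codimension_one_decomp[OF cod] by blast
  have decomp: "\<exists>k. \<exists>y\<in>A. z = scale k b + y" for z
    using b[of z] by (metis add.commute diff_add_cancel)
  have ba: "br b x \<in> A" if x: "x \<in> A" for x
  proof -
    obtain k y where y: "y \<in> A" and eq: "br b x = scale k b + y"
      using decomp by blast
    \<comment> \<open>The Zinbiel identity turns this into two copies of
      \<open>br b (br x x)\<close>, and \<open>br x x\<close> is 0.\<close>
    have "br (br b x) x = 0"
      by (simp add: zinbiel_identity br0 x br_zero_right)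
    then have "br (scale k b + y) x = 0"
      by (simp only: eq)
    then have "scale k (br b x) = 0"
      by (simp add: br_add_left br_scale_left br0 x y)
    then show ?thesis
      using eq y subspace_0[OF sub] by (auto simp: scale_eq_0_iff)
  qed
  have ab: "br x b \<in> A" if x: "x \<in> A" for x
  proof -
    obtain k y where y: "y \<in> A" and eq: "br x b = scale k b + y"
      using decomp by blast
    have xxb: "br (br x x) b = 0"
      by (simp add: br0 x br_zero_left)
    \<comment> \<open>By \<open>ba\<close> both factors lie in \<open>A\<close>, so the left-sided
      case must come first.\<close>
    have "br x (br b x) = 0"
      by (simp add: br0 x ba)
    with xxb have "br x (br x b) = 0"
      by (simp add: zinbiel_identity)
    then have "br x (scale k b + y) = 0"
      by (simp only: eq)
    then have "scale k (br x b) = 0"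
      by (simp add: br_add_right br_scale_right br0 x y)
    then show ?thesis
      using eq y subspace_0[OF sub] by (auto simp: scale_eq_0_iff)
  qed
  \<comment> \<open>The \<open>A\<close>-component of \<open>z\<close> multiplies \<open>x\<close>
    to 0, leaving multiples of \<open>br b x\<close> and \<open>br x b\<close>.\<close>
  have "br z x \<in> A \<and> br x z \<in> A" if x: "x \<in> A" for z x
  proof -
    obtain k y where "y \<in> A" "z = scale k b + y"
      using decomp by blast
    then show ?thesis
      using x ba[OF x] ab[OF x]
      by (simp add: br_add_left br_add_right br_scale_left br_scale_right br0 subspace_scale[OF sub])
  qed
  with sub show ?thesis
    by (simp add: two_sided_ideal_def)
qed

end

theorem theorem2p1:
  fixes scale :: "'f::field \<Rightarrow> 'z::ab_group_add \<Rightarrow> 'z"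
    and br :: "'z \<Rightarrow> 'z \<Rightarrow> 'z"
    and A :: "'z set"
  assumes "zinbiel_algebra scale br"
    and "zinbiel_algebra.abelian_subalgebra scale br A"
    and "vector_space.has_codimension scale A 1"
  shows "zinbiel_algebra.two_sided_ideal scale br A"
  using assms by (rule zinbiel_algebra.abelian_codimension_one_ideal)

end
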